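(* Let $\chi$ be a nonlinear kernel with data $(L,\psi,\alpha,\beta)$ relative to $\Pi=(t_k)_{k\in\mathbb{Z}}$. Let $f:\mathbb{R}^+\to\mathbb{R}$ be a bounded, locally log-Hölderian function of order $0<\nu\le1$. Suppose that $\psi$ is concave and satisfies $\psi(u)=\mathcal{O}(u^q)$ as $u\to0^+$, for some $0<q\le1$. Then there exist constants $C_1,C_2>0$ such that, for sufficiently large $w>0$: 1. if $\beta\ge1$, then $\|K^\chi_wf-f\|_\infty\le C_1w^{-l}$; 2. if $0<\beta<1$, then $\|K^\chi_wf-f\|_\infty\le C_2w^{-m}$, where $l:=\min\{\nu q,\alpha\}$ and $m:=\min\{\nu\beta q,\beta,\alpha\}$.
   Context: Notation: $\mathbb{R}^+=(0,\infty)$, $\mathbb{R}^+_0=[0,\infty)$; $\mu$ is the logarithmic (Haar) measure $\mu(A)=\int_A \frac{dt}{t}$ on $\mathbb{R}^+$, and $L^1_\mu(\mathbb{R}^+)$ the corresponding Lebesgue space; $\|\cdot\|_\infty$ is the sup norm on $\mathbb{R}^+$. The log-modulus of continuity is $\widetilde\omega(f,\delta'):=\sup\{|f(x)-f(y)|: x,y\in\mathbb{R}^+,\ |\ln x-\ln y|\le\delta'\}$, $\delta'>0$. A function $f:\mathbb{R}^+\to\mathbb{R}$ is locally log-Hölderian of order $0<\nu\le1$ if $\widetilde\omega(f,\delta')=\mathcal{O}(\delta'^{\,\nu})$ as $\delta'\to0^+$. $\Pi=(t_k)_{k\in\mathbb{Z}}$ is a sequence of real numbers with $t_k<t_{k+1}$,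 $\lim_{k\to\pm\infty}t_k=\pm\infty$, for which there are constants $\Delta,\delta>0$ with $\delta\le\Delta_k:=t_{k+1}-t_k\le\Delta$ for every $k\in\mathbb{Z}$. A nonlinear kernel with data $(L,\psi,\alpha,\beta)$, where $L:\mathbb{R}^+\to\mathbb{R}^+_0$ is measurable, $\psi:\mathbb{R}^+_0\to\mathbb{R}^+_0$ is non-decreasing and continuous with $\psi(0)=0$, and $\alpha,\beta>0$, is a function $\chi:\mathbb{R}^+\times\mathbb{R}\to\mathbb{R}$ such that: (1) $(\chi(e^{-t_k}x^w,u))_k\in\ell^1(\mathbb{Z})$ for every $x\in\mathbb{R}^+$, $u\in\mathbb{R}$, $w>0$; (2) $\chi(x,0)=0$ for every $x\in\mathbb{R}^+$; (3) $|\chi(x,u)-\chi(x,v)|\le L(x)\,\psi(|u-v|)$ for every $x\in\mathbb{R}^+$, $u,v\in\mathbb{R}$; (4) for every $j\in\mathbb{N}$ ($j\ge1$), $$\mathcal{S}^j_w(x):=\sup_{0\le|u|<1/j}\Big|\sum_{k\in\mathbb{Z}}\chi(e^{-t_k}x^w,u)-u\Big|=\mathcal{O}(w^{-\alpha}),\qquad \mathcal{T}^j_w(x):=\sup_{|u|\ge1/j}\Big|\frac1u\sum_{k\in\mathbb{Z}}\chi(e^{-t_k}x^w,u)-1\Big|=\mathcal{O}(w^{-\alpha})$$ as $w\to+\infty$, uniformly with respect to $x\in\mathbb{R}^+$; (5) $L\in L^1_\mu(\mathbb{R}^+)$ and $L$ is bounded; (6) $M_{\beta,\Pi}(L)<+\infty$,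 where $M_{\beta,\Pi}(L):=\sup_{x\in\mathbb{R}^+}\sum_{k\in\mathbb{Z}}L(e^{-t_k}x)\,|\ln x-t_k|^\beta$. For $w>0$ and a locally integrable $f:\mathbb{R}^+\to\mathbb{R}$ for which the series converges for every $x$, the nonlinear exponential Kantorovich sampling operator is $$(K^\chi_w f)(x):=\sum_{k\in\mathbb{Z}}\chi\Big(e^{-t_k}x^w,\ \frac{w}{\Delta_k}\int_{t_k/w}^{t_{k+1}/w}f(e^u)\,du\Big),\qquad x\in\mathbb{R}^+.$$ *)

theory Defs
  imports "HOL-Analysis.Analysis" "HOL-Library.Landau_Symbols"
begin

text \<open>
  Functions on the positive half-line are total functions on the reals; only their values at
  positive arguments (for \<open>\<psi>\<close>: at nonnegative arguments) are ever referred to.  Suprema that are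
  not known in advance to be finite are taken in the extended reals, so that a bound on such a
  supremum includes the assertion that it is finite.
\<close>

definition log_haar :: "real measure" where
  "log_haar = density (restrict_space lebesgue {0<..}) (\<lambda>t. ennreal (1 / t))"

definition sup_norm :: "(real \<Rightarrow> real) \<Rightarrow> ereal" where
  "sup_norm f = (SUP x\<in>{0<..}. ereal \<bar>f x\<bar>)"

definition log_modulus :: "(real \<Rightarrow> real) \<Rightarrow> real \<Rightarrow> ereal" where
  "log_modulus f d =
     (SUP (x, y)\<in>{(x, y). 0 < x \<and> 0 < y \<and> \<bar>ln x - ln y\<bar> \<le> d}. ereal \<bar>f x - f y\<bar>)"

definition locally_log_holder :: "real \<Rightarrow> (real \<Rightarrow> real) \<Rightarrow> bool" where
  "locally_log_holder \<nu> f \<longleftrightarrow>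
     (\<exists>C. \<forall>\<^sub>F d in at_right 0. log_modulus f d \<le> ereal (C * d powr \<nu>))"

locale sampling_nodes =
  fixes t :: "int \<Rightarrow> real"
  assumes nodes_less: "\<And>k. t k < t (k + 1)"
    and nodes_at_top: "filterlim t at_top at_top"
    and nodes_at_bot: "filterlim t at_bot at_bot"
    and nodes_gaps: "\<exists>\<delta>>0. \<exists>\<Delta>>0. \<forall>k. \<delta> \<le> t (k + 1) - t k \<and> t (k + 1) - t k \<le> \<Delta>"

definition kernel_S ::
  "(int \<Rightarrow> real) \<Rightarrow> (real \<Rightarrow> real \<Rightarrow> real) \<Rightarrow> nat \<Rightarrow> real \<Rightarrow> real \<Rightarrow> ereal" where
  "kernel_S t chi j w x =
     (SUP u\<in>{u. \<bar>u\<bar> < 1 / real j}. ereal \<bar>(\<Sum>\<^sub>\<infinity>k\<in>UNIV. chi (exp (- t k) * x powr w) u) - u\<bar>)"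

definition kernel_T ::
  "(int \<Rightarrow> real) \<Rightarrow> (real \<Rightarrow> real \<Rightarrow> real) \<Rightarrow> nat \<Rightarrow> real \<Rightarrow> real \<Rightarrow> ereal" where
  "kernel_T t chi j w x =
     (SUP u\<in>{u. \<bar>u\<bar> \<ge> 1 / real j}.
        ereal \<bar>1 / u * (\<Sum>\<^sub>\<infinity>k\<in>UNIV. chi (exp (- t k) * x powr w) u) - 1\<bar>)"

definition abs_moment :: "(int \<Rightarrow> real) \<Rightarrow> real \<Rightarrow> (real \<Rightarrow> real) \<Rightarrow> ennreal" where
  "abs_moment t \<beta> L =
     (SUP x\<in>{0<..}. \<Sum>\<^sub>\<infinity>k\<in>UNIV. ennreal (L (exp (- t k) * x) * \<bar>ln x - t k\<bar> powr \<beta>))"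

locale nonlinear_kernel = sampling_nodes t
  for t :: "int \<Rightarrow> real" +
  fixes L :: "real \<Rightarrow> real" and \<psi> :: "real \<Rightarrow> real" and \<alpha> \<beta> :: real
    and chi :: "real \<Rightarrow> real \<Rightarrow> real"
  assumes L_measurable: "L \<in> borel_measurable log_haar"
    and L_nonneg: "\<And>x. x > 0 \<Longrightarrow> L x \<ge> 0"
    and psi_nonneg: "\<And>u. u \<ge> 0 \<Longrightarrow> \<psi> u \<ge> 0"
    and psi_mono: "mono_on {0..} \<psi>"
    and psi_continuous: "continuous_on {0..} \<psi>"
    and psi_zero: "\<psi> 0 = 0"
    and alpha_pos: "\<alpha> > 0"
    and beta_pos: "\<beta> > 0"
    and chi_summable:
      "\<And>x u w. x > 0 \<Longrightarrow> w > 0 \<Longrightarrow> (\<lambda>k. \<bar>chi (exp (- t k) * x powr w) u\<bar>) summable_on UNIV"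
    and chi_zero: "\<And>x. x > 0 \<Longrightarrow> chi x 0 = 0"
    and chi_lipschitz: "\<And>x u v. x > 0 \<Longrightarrow> \<bar>chi x u - chi x v\<bar> \<le> L x * \<psi> \<bar>u - v\<bar>"
    and kernel_S_bigo:
      "\<And>j. j \<ge> 1 \<Longrightarrow> \<exists>C. \<forall>\<^sub>F w in at_top. \<forall>x>0. kernel_S t chi j w x \<le> ereal (C * w powr - \<alpha>)"
    and kernel_T_bigo:
      "\<And>j. j \<ge> 1 \<Longrightarrow> \<exists>C. \<forall>\<^sub>F w in at_top. \<forall>x>0. kernel_T t chi j w x \<le> ereal (C * w powr - \<alpha>)"
    and L_integrable: "integrable log_haar L"
    and L_bounded: "bounded (L ` {0<..})"
    and abs_moment_finite: "abs_moment t \<beta> L < \<infinity>"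

definition kantorovich ::
  "(int \<Rightarrow> real) \<Rightarrow> (real \<Rightarrow> real \<Rightarrow> real) \<Rightarrow> real \<Rightarrow> (real \<Rightarrow> real) \<Rightarrow> real \<Rightarrow> real" where
  "kantorovich t chi w f x =
     (\<Sum>\<^sub>\<infinity>k\<in>UNIV. chi (exp (- t k) * x powr w)
        (w / (t (k + 1) - t k) * (LINT u:{t k / w..t (k + 1) / w}|lebesgue. f (exp u))))"

end

theory Submission
  imports Defs
begin

text \<open>
  Since \<open>f\<close> is bounded, its local log-Hoelder condition is global and holds for every smaller order
  \<open>\<mu>\<close>; likewise \<open>\<psi> u \<le> D * u powr q\<close> on every bounded interval.  Hence replacing the averages of
  \<open>f\<close> by \<open>f x\<close> in the series costs at most a multiple of
  \<open>\<Sum>k. L (e^{-t_k} x^w) * ((\<bar>w ln x - t_k\<bar> + \<Delta>) / w) powr (\<mu> * q)\<close>, which is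
  \<open>O(w powr -(\<mu> * q))\<close> as soon as \<open>\<mu> * q \<le> \<beta>\<close>, because the moments of \<open>L\<close> of orders \<open>0\<close> and
  \<open>\<beta>\<close> are both finite.  What remains is controlled by the kernel condition at the single value
  \<open>f x\<close>.  The choices \<open>\<mu> = \<nu>\<close> and \<open>\<mu> = \<nu> * \<beta>\<close> give the two rates.
\<close>

section \<open>Hoelder bounds in the logarithmic variable, and interval averages\<close>

text \<open>At small distances the local condition applies, and lowering the exponent only enlarges
  powers of numbers below \<open>1\<close>. At distances bounded away from \<open>0\<close> the
  oscillation of a bounded function is absorbed into the constant.\<close>

lemma locally_log_holder_imp_holder:
  fixes f :: "real \<Rightarrow> real"
  assumes holder: "locally_log_holder \<nu> f" and bdd: "bounded (f ` {0<..})"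
    and \<mu>: "0 < \<mu>" "\<mu> \<le> \<nu>"
  obtains K where "K \<ge> 0" "\<And>u v. \<bar>f (exp u) - f (exp v)\<bar> \<le> K * \<bar>u - v\<bar> powr \<mu>"
proof -
  obtain M where M: "\<And>x. x > 0 \<Longrightarrow> \<bar>f x\<bar> \<le> M"
    using bdd unfolding bounded_iff by auto
  have M0: "M \<ge> 0" using M[of 1] by linarith
  obtain C b where b: "b > 0" and C: "\<And>d. 0 < d \<Longrightarrow> d < b \<Longrightarrow> log_modulus f d \<le> ereal (C * d powr \<nu>)"
    using holder unfolding locally_log_holder_def eventually_at_right_field by auto
  define b' where "b' = min b 1"
  have b': "0 < b'" "b' \<le> b" "b' \<le> 1" using b by (auto simp: b'_def)
  \<comment> \<open>The second summand makes \<open>K * d powr \<mu>\<close> at least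
    \<open>2 * M\<close> as soon as \<open>d \<ge> b'\<close>.\<close>
  define K where "K = \<bar>C\<bar> + 2 * M / b' powr \<mu>"
  have K0: "K \<ge> 0" using M0 by (simp add: K_def)
  have "\<bar>f (exp u) - f (exp v)\<bar> \<le> K * \<bar>u - v\<bar> powr \<mu>" for u v
  proof -
    define d where "d = \<bar>u - v\<bar>"
    consider "d = 0" | "0 < d" "d < b'" | "b' \<le> d"
      unfolding d_def by linarith
    then have "\<bar>f (exp u) - f (exp v)\<bar> \<le> K * d powr \<mu>"
    proof cases
      case 1
      then show ?thesis by (simp add: d_def)
    next
      case 2
      have "ereal \<bar>f (exp u) - f (exp v)\<bar> \<le> log_modulus f d"
        unfolding log_modulus_def
        by (rule SUP_upper2[of "(exp u, exp v)"]) (auto simp: d_def)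
      also have "\<dots> \<le> ereal (C * d powr \<nu>)" using C 2 b' by simp
      finally have "\<bar>f (exp u) - f (exp v)\<bar> \<le> C * d powr \<nu>" by simp
      also have "\<dots> \<le> \<bar>C\<bar> * d powr \<mu>"
        using 2 b' \<mu> by (intro mult_mono powr_mono') auto
      also have "\<dots> \<le> K * d powr \<mu>"
        using M0 by (intro mult_right_mono) (auto simp: K_def)
      finally show ?thesis .
    next
      case 3
      have "\<bar>f (exp u) - f (exp v)\<bar> \<le> 2 * M"
        using M[of "exp u"] M[of "exp v"] by simp
      also have "\<dots> = 2 * M / b' powr \<mu> * b' powr \<mu>" using b' by simp
      also have "\<dots> \<le> K * d powr \<mu>"
        using 3 b' \<mu> M0 by (intro mult_mono powr_mono2) (auto simp: K_def)
      finally show ?thesis .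
    qed
    then show ?thesis by (simp add: d_def)
  qed
  then show ?thesis using that K0 by blast
qed

lemma holder_continuous_on:
  fixes g :: "real \<Rightarrow> real"
  assumes g: "\<And>u v. \<bar>g u - g v\<bar> \<le> K * \<bar>u - v\<bar> powr \<mu>" and \<mu>: "\<mu> > 0"
  shows "continuous_on S g"
proof (rule continuous_at_imp_continuous_on, rule ballI)
  fix v
  \<comment> \<open>The base of the power tends to \<open>0\<close>; the limit still passes through
    \<open>powr\<close> because the base is nonnegative and the exponent positive.\<close>
  have "((\<lambda>u. K * \<bar>u - v\<bar> powr \<mu>) \<longlongrightarrow> K * \<bar>v - v\<bar> powr \<mu>) (at v)"
    using \<mu> by (intro tendsto_intros tendsto_powr2) (auto intro!: eventuallyI)
  then have "((\<lambda>u. K * \<bar>u - v\<bar> powr \<mu>) \<longlongrightarrow> 0) (at v)"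
    by simp
  then have "((\<lambda>u. g u - g v) \<longlongrightarrow> 0) (at v)"
    by (rule Lim_null_comparison[rotated]) (use g in \<open>auto intro!: eventuallyI\<close>)
  then show "isCont g v"
    unfolding isCont_def using LIM_zero_iff by blast
qed

text \<open>A constant is its own average, so the left side is the modulus of the average of
  \<open>g - c\<close>. Continuity guarantees that the Lebesgue integral is a genuine one and equals
  the gauge integral, for which the bound is available.\<close>

lemma interval_average_diff_le:
  fixes g :: "real \<Rightarrow> real"
  assumes cont: "continuous_on {a..b} g" and ab: "a < b"
    and B: "\<And>u. u \<in> {a..b} \<Longrightarrow> \<bar>g u - c\<bar> \<le> B"
  shows "\<bar>1 / (b - a) * (LINT u:{a..b}|lebesgue. g u) - c\<bar> \<le> B"
proof -
  have int: "g integrable_on {a..b}"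
    using cont by (rule integrable_continuous_real)
  have "(LINT u:{a..b}|lebesgue. g u) = integral {a..b} g"
    by (intro set_lebesgue_integral_eq_integral absolutely_integrable_continuous_real cont)
  moreover have "integral {a..b} (\<lambda>u. g u - c) = integral {a..b} g - c * (b - a)"
    using ab by (subst integral_diff[OF int]) auto
  moreover have "norm (integral {a..b} (\<lambda>u. g u - c)) \<le> B * (b - a)"
    using ab B by (intro integral_bound continuous_intros cont) auto
  ultimately have "\<bar>(LINT u:{a..b}|lebesgue. g u) - c * (b - a)\<bar> \<le> B * (b - a)" by simp
  moreover have "1 / (b - a) * (LINT u:{a..b}|lebesgue. g u) - c =
      ((LINT u:{a..b}|lebesgue. g u) - c * (b - a)) / (b - a)"
    using ab by (simp add: field_simps)
  ultimately show ?thesis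
    using ab by (simp add: abs_divide pos_divide_le_eq)
qed

section \<open>Elementary power bounds\<close>

text \<open>Monotonicity carries the rate at \<open>0\<close> to a whole bounded interval: away from
  \<open>0\<close>, \<open>\<psi>\<close> is at most its value at \<open>R\<close>, while
  \<open>u powr q\<close> is bounded below.\<close>

lemma mono_bigo_powr_imp_le:
  fixes \<psi> :: "real \<Rightarrow> real"
  assumes mono: "mono_on {0..} \<psi>" and zero: "\<psi> 0 = 0" and q: "0 < q"
    and bigo: "\<psi> \<in> O[at_right 0](\<lambda>u. u powr q)"
  obtains D where "D \<ge> 0" "\<And>u. 0 \<le> u \<Longrightarrow> u \<le> R \<Longrightarrow> \<psi> u \<le> D * u powr q"
proof -
  obtain c where c: "\<forall>\<^sub>F u in at_right 0. norm (\<psi> u) \<le> c * norm (u powr q)"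
    using bigo by (auto elim: landau_o.bigE)
  then obtain b where b: "b > 0" and bc: "\<And>u. 0 < u \<Longrightarrow> u < b \<Longrightarrow> \<bar>\<psi> u\<bar> \<le> c * u powr q"
    unfolding eventually_at_right_field by auto
  define D where "D = \<bar>c\<bar> + \<bar>\<psi> R\<bar> / b powr q"
  have "\<psi> u \<le> D * u powr q" if u: "0 \<le> u" "u \<le> R" for u
  proof -
    \<comment> \<open>The asymptotic bound says nothing at \<open>0\<close> itself; there both sides
      vanish.\<close>
    consider "u = 0" | "0 < u" "u < b" | "b \<le> u" using u by linarith
    then show ?thesis
    proof cases
      case 1
      then show ?thesis by (simp add: zero)
    next
      case 2
      have "\<psi> u \<le> c * u powr q" using bc[OF 2] by linarith
      also have "\<dots> \<le> D * u powr q"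
        by (intro mult_right_mono) (auto simp: D_def intro: add_increasing2)
      finally show ?thesis .
    next
      case 3
      have "\<psi> u \<le> \<bar>\<psi> R\<bar>"
        using mono_onD[OF mono, of u R] u by force
      also have "\<dots> = \<bar>\<psi> R\<bar> / b powr q * b powr q" using b by simp
      also have "\<dots> \<le> D * u powr q"
        using 3 b q by (intro mult_mono powr_mono2) (auto simp: D_def)
      finally show ?thesis .
    qed
  qed
  moreover have "D \<ge> 0" by (simp add: D_def)
  ultimately show ?thesis using that by blast
qed

text \<open>This reduces a shifted moment of intermediate order to those of orders \<open>0\<close>
  and \<open>\<beta>\<close>. The term \<open>1\<close> dominates for \<open>s \<le> 1\<close>; for
  larger \<open>s\<close> the shift costs a factor \<open>1 + \<Delta>\<close>, and raising the
  exponent to \<open>\<beta>\<close> only increases the power.\<close>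

lemma powr_add_le_moments:
  fixes s \<Delta> p \<beta> :: real
  assumes "0 \<le> s" "0 \<le> \<Delta>" "0 < p" "p \<le> \<beta>"
  shows "(s + \<Delta>) powr p \<le> (1 + \<Delta>) powr p * (1 + s powr \<beta>)"
proof (cases "s \<le> 1")
  case True
  have "(s + \<Delta>) powr p \<le> (1 + \<Delta>) powr p * 1"
    using True assms by (auto intro!: powr_mono2)
  also have "\<dots> \<le> (1 + \<Delta>) powr p * (1 + s powr \<beta>)"
    by (intro mult_left_mono) auto
  finally show ?thesis .
next
  case False
  have "s + \<Delta> \<le> (1 + \<Delta>) * s"
    using False assms mult_left_mono[of 1 s \<Delta>] by (simp add: algebra_simps)
  then have "(s + \<Delta>) powr p \<le> ((1 + \<Delta>) * s) powr p"
    using assms by (intro powr_mono2) auto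
  also have "\<dots> = (1 + \<Delta>) powr p * s powr p"
    using assms by (simp add: powr_mult)
  also have "\<dots> \<le> (1 + \<Delta>) powr p * (1 + s powr \<beta>)"
    using False assms powr_mono[of p \<beta> s] by (intro mult_left_mono add_increasing) auto
  finally show ?thesis .
qed

section \<open>Counting nodes\<close>

context sampling_nodes
begin

lemma nodes_diff_ge:
  assumes gap: "\<And>k. \<delta> \<le> t (k + 1) - t k" and ij: "i \<le> j"
  shows "\<delta> * of_int (j - i) \<le> t j - t i"
  using ij
proof (induction j rule: int_ge_induct)
  case base
  then show ?case by simp
next
  case (step j)
  then show ?case using gap[of j] by (simp add: algebra_simps)
qed

text \<open>The extreme nodes indexed by \<open>A\<close> are at most \<open>2\<close> apart, so
  uniform spacing bounds the difference of their indices by \<open>2 / \<delta>\<close>; the extra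
  \<open>1\<close> counts both ends. The bound is independent of \<open>y\<close>.\<close>

lemma card_nodes_near:
  assumes gap: "\<And>k. \<delta> \<le> t (k + 1) - t k" and \<delta>: "\<delta> > 0" and fin: "finite A"
    and near: "\<And>k. k \<in> A \<Longrightarrow> \<bar>y - t k\<bar> \<le> 1"
  shows "real (card A) \<le> 2 / \<delta> + 1"
proof (cases "A = {}")
  case True
  then show ?thesis using \<delta> by simp
next
  case False
  define i j where "i = Min A" and "j = Max A"
  have ij: "i \<in> A" "j \<in> A" "i \<le> j" "A \<subseteq> {i..j}"
    using False fin by (auto simp: i_def j_def)
  have "real (card A) \<le> real (card {i..j})"
    using ij by (intro of_nat_mono card_mono) auto
  also have "\<dots> = of_int (j - i) + 1" using ij by simp
  also have "of_int (j - i) \<le> 2 / \<delta>"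
  proof -
    have "\<delta> * of_int (j - i) \<le> t j - t i"
      using gap ij by (intro nodes_diff_ge)
    also have "\<dots> \<le> 2" using near[OF ij(1)] near[OF ij(2)] by linarith
    finally show ?thesis using \<delta> by (simp add: field_simps)
  qed
  finally show ?thesis by simp
qed

end

section \<open>Discrete moments of \<open>L\<close>\<close>

context nonlinear_kernel
begin

text \<open>Moments enter only through finite partial sums, bounded uniformly in \<open>F\<close>
  and \<open>x\<close>. This turns the extended supremum into a real bound and leaves no summability
  question about the moment series.\<close>

lemma moment_beta_sum_le:
  obtains B where "\<And>F x. finite F \<Longrightarrow> x > 0 \<Longrightarrow>
    (\<Sum>k\<in>F. L (exp (- t k) * x) * \<bar>ln x - t k\<bar> powr \<beta>) \<le> B"
proof
  fix F :: "int set" and x :: real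
  assume F: "finite F" and x: "x > 0"
  let ?a = "\<lambda>k. L (exp (- t k) * x) * \<bar>ln x - t k\<bar> powr \<beta>"
  have "ennreal (sum ?a F) = (\<Sum>k\<in>F. ennreal (?a k))"
    using x by (intro sum_ennreal[symmetric]) (auto intro!: mult_nonneg_nonneg L_nonneg)
  also have "\<dots> = (\<Sum>\<^sub>\<infinity>k\<in>F. ennreal (?a k))" using F by simp
  also have "\<dots> \<le> (\<Sum>\<^sub>\<infinity>k\<in>UNIV. ennreal (?a k))"
    by (intro infsum_mono_neutral nonneg_summable_on_complete) auto
  also have "\<dots> \<le> abs_moment t \<beta> L"
    unfolding abs_moment_def using x by (intro SUP_upper) auto
  finally have "ennreal (sum ?a F) \<le> ennreal (enn2real (abs_moment t \<beta> L))"
    using abs_moment_finite by simp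
  then show "sum ?a F \<le> enn2real (abs_moment t \<beta> L)"
    by (simp add: ennreal_le_iff)
qed

text \<open>
  Only boundedly many nodes lie within distance \<open>1\<close> of \<open>ln x\<close>, and \<open>L\<close> is bounded; at the other
  nodes the weight \<open>\<bar>ln x - t k\<bar> powr \<beta>\<close> is at least \<open>1\<close>.
\<close>

lemma moment_zero_sum_le:
  obtains B where "\<And>F x. finite F \<Longrightarrow> x > 0 \<Longrightarrow> (\<Sum>k\<in>F. L (exp (- t k) * x)) \<le> B"
proof -
  obtain B where B: "\<And>F x. finite F \<Longrightarrow> x > 0 \<Longrightarrow>
      (\<Sum>k\<in>F. L (exp (- t k) * x) * \<bar>ln x - t k\<bar> powr \<beta>) \<le> B"
    using moment_beta_sum_le by blast
  obtain \<delta> where \<delta>: "\<delta> > 0" and gap: "\<And>k. \<delta> \<le> t (k + 1) - t k"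
    using nodes_gaps by blast
  obtain N where N: "\<And>x. x > 0 \<Longrightarrow> \<bar>L x\<bar> \<le> N"
    using L_bounded unfolding bounded_iff by auto
  have N0: "N \<ge> 0" using N[of 1] by linarith
  have "(\<Sum>k\<in>F. L (exp (- t k) * x)) \<le> N * (2 / \<delta> + 1) + B" if F: "finite F" and x: "x > 0" for F x
  proof -
    define A where "A = {k \<in> F. \<bar>ln x - t k\<bar> \<le> 1}"
    have A: "A \<subseteq> F" "finite A" using F by (auto simp: A_def)
    have pos: "L (exp (- t k) * x) \<ge> 0" for k using x by (intro L_nonneg) auto
    have "(\<Sum>k\<in>A. L (exp (- t k) * x)) \<le> real (card A) * N"
      using N x by (intro sum_bounded_above) (meson abs_le_D1 exp_gt_zero mult_pos_pos)
    also have "\<dots> \<le> (2 / \<delta> + 1) * N"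
      using card_nodes_near[OF gap \<delta> A(2), of "ln x"] N0
      by (intro mult_right_mono) (auto simp: A_def)
    finally have near: "(\<Sum>k\<in>A. L (exp (- t k) * x)) \<le> N * (2 / \<delta> + 1)"
      by (simp add: mult.commute)
    have "(\<Sum>k\<in>F - A. L (exp (- t k) * x))
        \<le> (\<Sum>k\<in>F - A. L (exp (- t k) * x) * \<bar>ln x - t k\<bar> powr \<beta>)"
    proof (rule sum_mono)
      fix k assume "k \<in> F - A"
      then have "1 \<le> \<bar>ln x - t k\<bar> powr \<beta>"
        using beta_pos by (auto simp: A_def intro!: ge_one_powr_ge_zero)
      then show "L (exp (- t k) * x) \<le> L (exp (- t k) * x) * \<bar>ln x - t k\<bar> powr \<beta>"
        using mult_left_mono[OF _ pos[of k]] by fastforce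
    qed
    also have "\<dots> \<le> B" using B F x by simp
    finally show ?thesis
      using near sum.subset_diff[OF A(1) F, of "\<lambda>k. L (exp (- t k) * x)"] by linarith
  qed
  then show ?thesis using that by blast
qed

text \<open>The shift \<open>\<Delta>\<close> allows for the length of the averaging intervals,
  whose points may be that much farther from \<open>ln x\<close> than the node
  \<open>t k\<close>.\<close>

lemma weighted_moment_sum_le:
  assumes \<Delta>: "0 \<le> \<Delta>" and p: "0 < p" "p \<le> \<beta>"
  obtains B where "\<And>F x. finite F \<Longrightarrow> x > 0 \<Longrightarrow>
    (\<Sum>k\<in>F. L (exp (- t k) * x) * (\<bar>ln x - t k\<bar> + \<Delta>) powr p) \<le> B"
proof -
  obtain B0 where B0: "\<And>F x. finite F \<Longrightarrow> x > 0 \<Longrightarrow> (\<Sum>k\<in>F. L (exp (- t k) * x)) \<le> B0"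
    using moment_zero_sum_le by blast
  obtain B1 where B1: "\<And>F x. finite F \<Longrightarrow> x > 0 \<Longrightarrow>
      (\<Sum>k\<in>F. L (exp (- t k) * x) * \<bar>ln x - t k\<bar> powr \<beta>) \<le> B1"
    using moment_beta_sum_le by blast
  have "(\<Sum>k\<in>F. L (exp (- t k) * x) * (\<bar>ln x - t k\<bar> + \<Delta>) powr p)
      \<le> (1 + \<Delta>) powr p * (B0 + B1)" if F: "finite F" and x: "x > 0" for F x
  proof -
    have "(\<Sum>k\<in>F. L (exp (- t k) * x) * (\<bar>ln x - t k\<bar> + \<Delta>) powr p)
        \<le> (\<Sum>k\<in>F. L (exp (- t k) * x) * ((1 + \<Delta>) powr p * (1 + \<bar>ln x - t k\<bar> powr \<beta>)))"
      using x \<Delta> p by (intro sum_mono mult_left_mono powr_add_le_moments L_nonneg) auto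
    also have "\<dots> = (1 + \<Delta>) powr p * ((\<Sum>k\<in>F. L (exp (- t k) * x)) +
        (\<Sum>k\<in>F. L (exp (- t k) * x) * \<bar>ln x - t k\<bar> powr \<beta>))"
      by (simp add: sum_distrib_left sum.distrib[symmetric] algebra_simps)
    also have "\<dots> \<le> (1 + \<Delta>) powr p * (B0 + B1)"
      using B0[OF F x] B1[OF F x] by (intro mult_left_mono add_mono) auto
    finally show ?thesis .
  qed
  then show ?thesis using that by blast
qed

section \<open>Comparison of kernel series\<close>

text \<open>Summability is given only for a constant second argument. The termwise differences are
  absolutely summable because their partial sums are bounded by \<open>B\<close>, so the series with
  varying arguments converges too and may be subtracted termwise.\<close>

lemma kernel_sum_diff_le:
  assumes x: "x > 0" and w: "w > 0"
    and B: "\<And>F. finite F \<Longrightarrow> (\<Sum>k\<in>F. L (exp (- t k) * x powr w) * \<psi> \<bar>a k - c\<bar>) \<le> B"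
  shows "\<bar>(\<Sum>\<^sub>\<infinity>k. chi (exp (- t k) * x powr w) (a k)) -
           (\<Sum>\<^sub>\<infinity>k. chi (exp (- t k) * x powr w) c)\<bar> \<le> B"
proof -
  define d where "d k = chi (exp (- t k) * x powr w) (a k) - chi (exp (- t k) * x powr w) c" for k
  have fin: "(\<Sum>k\<in>F. \<bar>d k\<bar>) \<le> B" if "finite F" for F
  proof -
    have "(\<Sum>k\<in>F. \<bar>d k\<bar>) \<le> (\<Sum>k\<in>F. L (exp (- t k) * x powr w) * \<psi> \<bar>a k - c\<bar>)"
      unfolding d_def using x by (intro sum_mono chi_lipschitz) auto
    then show ?thesis using B[OF that] by linarith
  qed
  have d_abs: "(\<lambda>k. norm (d k)) summable_on UNIV"
    by (rule nonneg_bdd_above_summable_on) (auto intro!: bdd_aboveI2[where M = B] fin)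
  have c_sum: "(\<lambda>k. chi (exp (- t k) * x powr w) c) summable_on UNIV"
    using chi_summable[OF x w, of c] by (simp add: abs_summable_summable)
  have "(\<lambda>k. chi (exp (- t k) * x powr w) (a k)) = (\<lambda>k. d k + chi (exp (- t k) * x powr w) c)"
    by (simp add: d_def)
  then have "(\<Sum>\<^sub>\<infinity>k. chi (exp (- t k) * x powr w) (a k)) =
      infsum d UNIV + (\<Sum>\<^sub>\<infinity>k. chi (exp (- t k) * x powr w) c)"
    using infsum_add[OF abs_summable_summable[OF d_abs] c_sum] by simp
  moreover have "norm (infsum d UNIV) \<le> (\<Sum>\<^sub>\<infinity>k. norm (d k))"
    by (rule norm_infsum_bound[OF d_abs])
  moreover have "(\<Sum>\<^sub>\<infinity>k. norm (d k)) \<le> B"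
    by (rule infsum_le_finite_sums[OF d_abs]) (simp add: fin)
  ultimately show ?thesis by simp
qed

text \<open>The kernel condition for \<open>j = 1\<close> suffices: \<open>kernel_S\<close> treats
  \<open>\<bar>u\<bar> < 1\<close>, and for \<open>1 \<le> \<bar>u\<bar> \<le> M\<close> the
  relative error bounded by \<open>kernel_T\<close> becomes an absolute one at the cost of a factor
  \<open>M\<close>.\<close>

lemma kernel_sum_approx:
  assumes M: "M \<ge> 0"
  obtains C where "C \<ge> 0" "\<forall>\<^sub>F w in at_top. \<forall>x>0. \<forall>u. \<bar>u\<bar> \<le> M \<longrightarrow>
    \<bar>(\<Sum>\<^sub>\<infinity>k. chi (exp (- t k) * x powr w) u) - u\<bar> \<le> C * w powr - \<alpha>"
proof -
  obtain CS where CS: "\<forall>\<^sub>F w in at_top. \<forall>x>0. kernel_S t chi 1 w x \<le> ereal (CS * w powr - \<alpha>)"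
    using kernel_S_bigo[of 1] by auto
  obtain CT where CT: "\<forall>\<^sub>F w in at_top. \<forall>x>0. kernel_T t chi 1 w x \<le> ereal (CT * w powr - \<alpha>)"
    using kernel_T_bigo[of 1] by auto
  \<comment> \<open>The constants of the two asymptotic bounds carry no sign, hence the absolute
    values.\<close>
  define C where "C = \<bar>CS\<bar> + M * \<bar>CT\<bar>"
  have "\<forall>\<^sub>F w in at_top. \<forall>x>0. \<forall>u. \<bar>u\<bar> \<le> M \<longrightarrow>
    \<bar>(\<Sum>\<^sub>\<infinity>k. chi (exp (- t k) * x powr w) u) - u\<bar> \<le> C * w powr - \<alpha>"
    using CS CT
  proof eventually_elim
    case (elim w)
    show ?case
    proof (intro allI impI)
      fix x u :: real assume x: "x > 0" and u: "\<bar>u\<bar> \<le> M"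
      let ?s = "\<Sum>\<^sub>\<infinity>k. chi (exp (- t k) * x powr w) u"
      show "\<bar>?s - u\<bar> \<le> C * w powr - \<alpha>"
      proof (cases "\<bar>u\<bar> < 1")
        case True
        have "ereal \<bar>?s - u\<bar> \<le> kernel_S t chi 1 w x"
          unfolding kernel_S_def using True by (intro SUP_upper) auto
        also have "\<dots> \<le> ereal (CS * w powr - \<alpha>)" using elim x by auto
        finally have "\<bar>?s - u\<bar> \<le> CS * w powr - \<alpha>" by simp
        also have "\<dots> \<le> C * w powr - \<alpha>"
          using M by (intro mult_right_mono) (auto simp: C_def intro: add_increasing2)
        finally show ?thesis .
      next
        case False
        have "ereal \<bar>1 / u * ?s - 1\<bar> \<le> kernel_T t chi 1 w x"
          unfolding kernel_T_def using False by (intro SUP_upper) auto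
        also have "\<dots> \<le> ereal (CT * w powr - \<alpha>)" using elim x by auto
        finally have *: "\<bar>1 / u * ?s - 1\<bar> \<le> CT * w powr - \<alpha>" by simp
        have "?s - u = u * (1 / u * ?s - 1)" using False by (auto simp: field_simps)
        then have "\<bar>?s - u\<bar> = \<bar>u\<bar> * \<bar>1 / u * ?s - 1\<bar>" by (metis abs_mult)
        also have "\<dots> \<le> M * (\<bar>CT\<bar> * w powr - \<alpha>)"
        proof (intro mult_mono u M)
          show "\<bar>1 / u * ?s - 1\<bar> \<le> \<bar>CT\<bar> * w powr - \<alpha>"
            by (rule order_trans[OF *]) (intro mult_right_mono, auto)
        qed auto
        also have "\<dots> \<le> C * w powr - \<alpha>"
          by (auto simp: C_def algebra_simps)
        finally show ?thesis .
      qed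
    qed
  qed
  moreover have "C \<ge> 0" using M by (simp add: C_def)
  ultimately show ?thesis using that by blast
qed

section \<open>The rate of approximation\<close>

text \<open>The triangle inequality passes through the kernel series at the constant value
  \<open>f x\<close>. The two errors have orders \<open>\<mu> * q\<close> and
  \<open>\<alpha>\<close>, and any \<open>m\<close> below both is admissible once
  \<open>w \<ge> 1\<close>.\<close>

lemma kantorovich_rate:
  assumes bdd: "bounded (f ` {0<..})"
    and holder: "locally_log_holder \<nu> f" and \<mu>: "0 < \<mu>" "\<mu> \<le> \<nu>"
    and q: "0 < q" and bigo: "\<psi> \<in> O[at_right 0](\<lambda>u. u powr q)"
    and le: "\<mu> * q \<le> \<beta>" and m: "m \<le> \<mu> * q" "m \<le> \<alpha>"
  shows "\<exists>C>0. \<forall>\<^sub>F w in at_top.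
    sup_norm (\<lambda>x. kantorovich t chi w f x - f x) \<le> ereal (C * w powr - m)"
proof -
  obtain M where M: "\<And>x. x > 0 \<Longrightarrow> \<bar>f x\<bar> \<le> M"
    using bdd unfolding bounded_iff by auto
  have M0: "M \<ge> 0" using M[of 1] by linarith
  obtain K where K0: "K \<ge> 0" and K: "\<And>u v. \<bar>f (exp u) - f (exp v)\<bar> \<le> K * \<bar>u - v\<bar> powr \<mu>"
    using locally_log_holder_imp_holder[OF holder bdd \<mu>] by blast
  have cont: "continuous_on S (\<lambda>u. f (exp u))" for S
    using K \<mu>(1) by (rule holder_continuous_on)
  \<comment> \<open>The averages of \<open>f\<close> and the value \<open>f x\<close> differ by at
    most \<open>2 * M\<close>, so \<open>\<psi>\<close> needs control only on this interval.\<close>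
  obtain D where D0: "D \<ge> 0" and D: "\<And>u. 0 \<le> u \<Longrightarrow> u \<le> 2 * M \<Longrightarrow> \<psi> u \<le> D * u powr q"
    using mono_bigo_powr_imp_le[OF psi_mono psi_zero q bigo] by blast
  obtain \<Delta> where \<Delta>: "\<Delta> > 0" and gap: "\<And>k. t (k + 1) - t k \<le> \<Delta>"
    using nodes_gaps by blast
  define p where "p = \<mu> * q"
  have p: "0 < p" "p \<le> \<beta>" using \<mu> q le by (auto simp: p_def)
  obtain B where B: "\<And>F x. finite F \<Longrightarrow> x > 0 \<Longrightarrow>
      (\<Sum>k\<in>F. L (exp (- t k) * x) * (\<bar>ln x - t k\<bar> + \<Delta>) powr p) \<le> B"
    using weighted_moment_sum_le[OF less_imp_le[OF \<Delta>] p] by blast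
  have B0: "B \<ge> 0" using B[of "{}" 1] by simp
  obtain C where C0: "C \<ge> 0" and C: "\<forall>\<^sub>F w in at_top. \<forall>x>0. \<forall>u. \<bar>u\<bar> \<le> M \<longrightarrow>
      \<bar>(\<Sum>\<^sub>\<infinity>k. chi (exp (- t k) * x powr w) u) - u\<bar> \<le> C * w powr - \<alpha>"
    using kernel_sum_approx[OF M0] by blast
  \<comment> \<open>\<open>E\<close> collects the factors when the Hoelder bound
    \<open>K * y powr \<mu>\<close> is inserted into \<open>D * u powr q\<close>.\<close>
  define E where "E = D * K powr q"
  have E0: "E \<ge> 0" using D0 by (simp add: E_def)
  \<comment> \<open>The summand \<open>1\<close> only keeps the constant strictly positive.\<close>
  have "\<forall>\<^sub>F w in at_top. sup_norm (\<lambda>x. kantorovich t chi w f x - f x)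
      \<le> ereal ((E * B + C + 1) * w powr - m)"
    using C eventually_ge_at_top[of 1]
  proof eventually_elim
    case (elim w)
    then have w: "w > 0" "w \<ge> 1" by auto
    show ?case
      unfolding sup_norm_def
    proof (rule SUP_least)
      fix x :: real assume "x \<in> {0<..}"
      then have x: "x > 0" by simp
      define a where
        "a k = w / (t (k + 1) - t k) * (LINT u:{t k / w..t (k + 1) / w}|lebesgue. f (exp u))" for k
      define s where "s k = \<bar>ln (x powr w) - t k\<bar>" for k
      have average: "a k =
          1 / (t (k + 1) / w - t k / w) * (LINT u:{t k / w..t (k + 1) / w}|lebesgue. f (exp u))" for k
        unfolding a_def by (simp add: diff_divide_distrib[symmetric])
      have lt: "t k / w < t (k + 1) / w" for k
        using nodes_less[of k] w by (simp add: divide_strict_right_mono)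
      have a1: "\<bar>a k - f x\<bar> \<le> K * ((s k + \<Delta>) / w) powr \<mu>" for k
        unfolding average
      proof (rule interval_average_diff_le[OF cont lt])
        fix u assume u: "u \<in> {t k / w..t (k + 1) / w}"
        \<comment> \<open>After scaling by \<open>w\<close>, the point lies in the gap starting at
          \<open>t k\<close>, hence within \<open>\<Delta>\<close> of that node.\<close>
        have "w * u \<ge> t k" "w * u \<le> t (k + 1)" using u w by (auto simp: field_simps)
        then have "\<bar>w * u - w * ln x\<bar> \<le> s k + \<Delta>"
          using gap[of k] x by (simp add: s_def ln_powr)
        moreover have "\<bar>w * u - w * ln x\<bar> = w * \<bar>u - ln x\<bar>"
          using w by (simp add: right_diff_distrib[symmetric] abs_mult)
        ultimately have "\<bar>u - ln x\<bar> \<le> (s k + \<Delta>) / w"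
          using w by (simp add: field_simps)
        then have "K * \<bar>u - ln x\<bar> powr \<mu> \<le> K * ((s k + \<Delta>) / w) powr \<mu>"
          using K0 \<mu> by (intro mult_left_mono powr_mono2) auto
        then show "\<bar>f (exp u) - f x\<bar> \<le> K * ((s k + \<Delta>) / w) powr \<mu>"
          using K[of u "ln x"] x by simp
      qed
      have a2: "\<bar>a k - f x\<bar> \<le> 2 * M" for k
        unfolding average
      proof (rule interval_average_diff_le[OF cont lt])
        fix u show "\<bar>f (exp u) - f x\<bar> \<le> 2 * M"
          using M[OF x] M[of "exp u"] by simp
      qed
      have psi_le: "\<psi> \<bar>a k - f x\<bar> \<le> E * w powr - p * (s k + \<Delta>) powr p" for k
      proof -
        have s0: "s k + \<Delta> \<ge> 0" using \<Delta> by (simp add: s_def)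
        \<comment> \<open>The crude bound \<open>a2\<close> admits the power estimate for
          \<open>\<psi>\<close>; the fine bound \<open>a1\<close> then supplies the decay in
          \<open>w\<close>.\<close>
        have "\<psi> \<bar>a k - f x\<bar> \<le> D * \<bar>a k - f x\<bar> powr q" using a2 by (intro D) auto
        also have "\<dots> \<le> D * (K * ((s k + \<Delta>) / w) powr \<mu>) powr q"
          using a1 q D0 by (intro mult_left_mono powr_mono2) auto
        also have "\<dots> = E * ((s k + \<Delta>) / w) powr p"
          using K0 by (simp add: E_def p_def powr_mult powr_powr)
        also have "\<dots> = E * w powr - p * (s k + \<Delta>) powr p"
          using s0 w by (simp add: powr_divide powr_minus field_simps)
        finally show ?thesis .
      qed
      have "\<bar>(\<Sum>\<^sub>\<infinity>k. chi (exp (- t k) * x powr w) (a k)) -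
           (\<Sum>\<^sub>\<infinity>k. chi (exp (- t k) * x powr w) (f x))\<bar> \<le> E * w powr - p * B"
      proof (rule kernel_sum_diff_le[OF x w(1)])
        fix F :: "int set" assume F: "finite F"
        have "(\<Sum>k\<in>F. L (exp (- t k) * x powr w) * \<psi> \<bar>a k - f x\<bar>)
            \<le> (\<Sum>k\<in>F. L (exp (- t k) * x powr w) * (E * w powr - p * (s k + \<Delta>) powr p))"
          using x by (intro sum_mono mult_left_mono psi_le L_nonneg) auto
        also have "\<dots> = E * w powr - p *
            (\<Sum>k\<in>F. L (exp (- t k) * x powr w) * (s k + \<Delta>) powr p)"
          by (simp add: sum_distrib_left algebra_simps)
        \<comment> \<open>The moment bound is taken at the point \<open>x powr w\<close>; since
          \<open>B\<close> holds at every positive point, the estimate is uniform in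
          \<open>x\<close> and \<open>w\<close>.\<close>
        also have "\<dots> \<le> E * w powr - p * B"
          using B[OF F, of "x powr w"] x E0 by (intro mult_left_mono) (auto simp: s_def)
        finally show "(\<Sum>k\<in>F. L (exp (- t k) * x powr w) * \<psi> \<bar>a k - f x\<bar>)
            \<le> E * w powr - p * B" .
      qed
      moreover have "\<bar>(\<Sum>\<^sub>\<infinity>k. chi (exp (- t k) * x powr w) (f x)) - f x\<bar> \<le> C * w powr - \<alpha>"
        using elim x M by blast
      moreover have "kantorovich t chi w f x = (\<Sum>\<^sub>\<infinity>k. chi (exp (- t k) * x powr w) (a k))"
        by (simp add: kantorovich_def a_def)
      ultimately have "\<bar>kantorovich t chi w f x - f x\<bar> \<le> E * B * w powr - p + C * w powr - \<alpha>"
        by (simp add: algebra_simps)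
      also have "\<dots> \<le> E * B * w powr - m + C * w powr - m"
        using w m E0 B0 C0 by (intro add_mono mult_left_mono powr_mono) (auto simp: p_def)
      also have "\<dots> \<le> (E * B + C + 1) * w powr - m"
        by (simp add: algebra_simps)
      finally show "ereal \<bar>kantorovich t chi w f x - f x\<bar> \<le> ereal ((E * B + C + 1) * w powr - m)"
        by simp
    qed
  qed
  moreover have "E * B + C + 1 > 0" using E0 B0 C0 by (simp add: add_nonneg_pos)
  ultimately show ?thesis by blast
qed

end

theorem corollary8:
  fixes t :: "int \<Rightarrow> real" and L \<psi> f :: "real \<Rightarrow> real" and \<alpha> \<beta> \<nu> q :: real
    and chi :: "real \<Rightarrow> real \<Rightarrow> real"
  assumes "nonlinear_kernel t L \<psi> \<alpha> \<beta> chi"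
    and "bounded (f ` {0<..})"
    and "0 < \<nu>" and "\<nu> \<le> 1" and "locally_log_holder \<nu> f"
    and "concave_on {0..} \<psi>"
    and "0 < q" and "q \<le> 1" and "\<psi> \<in> O[at_right 0](\<lambda>u. u powr q)"
  shows "\<exists>C1>0. \<exists>C2>0. \<forall>\<^sub>F w in at_top.
    (\<beta> \<ge> 1 \<longrightarrow> sup_norm (\<lambda>x. kantorovich t chi w f x - f x)
                   \<le> ereal (C1 * w powr - min (\<nu> * q) \<alpha>)) \<and>
    (0 < \<beta> \<and> \<beta> < 1 \<longrightarrow> sup_norm (\<lambda>x. kantorovich t chi w f x - f x)
                   \<le> ereal (C2 * w powr - Min {\<nu> * \<beta> * q, \<beta>, \<alpha>}))"
proof -
  interpret nonlinear_kernel t L \<psi> \<alpha> \<beta> chi by fact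
  \<comment> \<open>This yields \<open>\<mu> * q \<le> \<beta>\<close> in both cases: directly for
    \<open>\<mu> = \<nu>\<close> when \<open>\<beta> \<ge> 1\<close>, and after multiplication by
    \<open>\<beta>\<close> for \<open>\<mu> = \<nu> * \<beta>\<close>.\<close>
  have \<nu>q: "\<nu> * q \<le> 1" using assms by (simp add: mult_le_one)
  note rate = kantorovich_rate[OF assms(2,5) _ _ assms(7,9)]
  show ?thesis
  proof (cases "\<beta> \<ge> 1")
    case True
    have "\<exists>C>0. \<forall>\<^sub>F w in at_top. sup_norm (\<lambda>x. kantorovich t chi w f x - f x)
        \<le> ereal (C * w powr - min (\<nu> * q) \<alpha>)"
      using \<nu>q True assms(3) by (intro rate[of \<nu>]) auto
    then obtain C where "C > 0" "\<forall>\<^sub>F w in at_top. sup_norm (\<lambda>x. kantorovich t chi w f x - f x)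
        \<le> ereal (C * w powr - min (\<nu> * q) \<alpha>)"
      by blast
    \<comment> \<open>The same \<open>C\<close> serves as both witnesses, the other implication
      being vacuous for this \<open>\<beta>\<close>.\<close>
    with True show ?thesis by (intro exI[of _ C] conjI) (auto elim: eventually_mono)
  next
    case False
    have "\<nu> * \<beta> * q \<le> \<beta>"
      using mult_left_mono[OF \<nu>q, of \<beta>] beta_pos by (simp add: mult_ac)
    then have "\<exists>C>0. \<forall>\<^sub>F w in at_top. sup_norm (\<lambda>x. kantorovich t chi w f x - f x)
        \<le> ereal (C * w powr - Min {\<nu> * \<beta> * q, \<beta>, \<alpha>})"
      using False beta_pos assms(3) by (intro rate[of "\<nu> * \<beta>"]) auto
    then obtain C where "C > 0" "\<forall>\<^sub>F w in at_top. sup_norm (\<lambda>x. kantorovich t chi w f x - f x)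
        \<le> ereal (C * w powr - Min {\<nu> * \<beta> * q, \<beta>, \<alpha>})"
      by blast
    with False show ?thesis by (intro exI[of _ C] conjI) (auto elim: eventually_mono)
  qed
qed

end
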